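(* Let $k\ge 1$ and let $n_1,\dots,n_k\ge 2$ be integers. The zero-divisor graph $\Gamma(\mathbb{Z}_{n_1}\times\mathbb{Z}_{n_2}\times\cdots\times\mathbb{Z}_{n_k})$ is perfect if and only if there exist pairwise coprime positive integers $m_1,\dots,m_k$ such that, for each $i$, $m_i$ has the same number of distinct prime factors as $n_i$ with the same exponents in its prime factorization (i.e. if $n_i=p_{1}^{a_1}\cdots p_{s}^{a_s}$ with distinct primes $p_j$, then $m_i=q_1^{a_1}\cdots q_s^{a_s}$ for some distinct primes $q_j$), and $\Gamma(\mathbb{Z}_{m_1m_2\cdots m_k})$ is perfect.
   Context: For a commutative ring $R$ with identity, the zero-divisor graph $\Gamma(R)$ is the simple undirected graph whose vertices are the nonzero zero-divisors of $R$, two distinct vertices $u,v$ being adjacent iff $uv=0$. A graph is perfect if for every induced subgraph the chromatic number equals the clique number. *)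

theory Defs
  imports
    "HOL-Algebra.Chinese_Remainder"
    "HOL-Number_Theory.Residues"
    "Graph_Theory.Digraph_Component"
    "Graph_Theory.Pair_Digraph"
begin

text \<open>
  Simple undirected graphs are represented as in Graph-Theory, namely as symmetric loop-free
  digraphs without parallel arcs (locale \<^locale>\<open>graph\<close>). The chromatic number, the clique
  number and perfection are meant for finite graphs. The empty set counts as a clique, so that both
  numbers are 0 for the null graph.
\<close>

definition proper_colouring :: "('a, 'b) pre_digraph \<Rightarrow> nat \<Rightarrow> ('a \<Rightarrow> nat) \<Rightarrow> bool" where
  "proper_colouring G c f \<longleftrightarrow>
     f ` verts G \<subseteq> {..<c} \<and>
     (\<forall>u\<in>verts G. \<forall>v\<in>verts G. u \<rightarrow>\<^bsub>G\<^esub> v \<longrightarrow> f u \<noteq> f v)"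

definition chromatic_number :: "('a, 'b) pre_digraph \<Rightarrow> nat" where
  "chromatic_number G = (LEAST c. \<exists>f. proper_colouring G c f)"

definition clique :: "('a, 'b) pre_digraph \<Rightarrow> 'a set \<Rightarrow> bool" where
  "clique G C \<longleftrightarrow> C \<subseteq> verts G \<and> (\<forall>u\<in>C. \<forall>v\<in>C. u \<noteq> v \<longrightarrow> u \<rightarrow>\<^bsub>G\<^esub> v)"

definition clique_number :: "('a, 'b) pre_digraph \<Rightarrow> nat" where
  "clique_number G = Max {card C |C. clique G C}"

definition perfect_graph :: "('a, 'b) pre_digraph \<Rightarrow> bool" where
  "perfect_graph G \<longleftrightarrow>
     (\<forall>H. induced_subgraph H G \<longrightarrow> chromatic_number H = clique_number H)"

definition nonzero_zero_divisors :: "('a, 'm) ring_scheme \<Rightarrow> 'a set" where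
  "nonzero_zero_divisors R =
     {x \<in> carrier R. x \<noteq> \<zero>\<^bsub>R\<^esub> \<and> (\<exists>y\<in>carrier R. y \<noteq> \<zero>\<^bsub>R\<^esub> \<and> x \<otimes>\<^bsub>R\<^esub> y = \<zero>\<^bsub>R\<^esub>)}"

definition zero_divisor_graph :: "('a, 'm) ring_scheme \<Rightarrow> 'a pair_pre_digraph" where
  "zero_divisor_graph R =
     \<lparr> pverts = nonzero_zero_divisors R,
       parcs = {(u, v). u \<in> nonzero_zero_divisors R \<and> v \<in> nonzero_zero_divisors R \<and>
                        u \<noteq> v \<and> u \<otimes>\<^bsub>R\<^esub> v = \<zero>\<^bsub>R\<^esub>} \<rparr>"

lemma pair_graph_zero_divisor_graph:
  assumes "cring R" and "finite (carrier R)"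
  shows "pair_graph (zero_divisor_graph R)"
proof -
  interpret cring R by fact
  let ?V = "nonzero_zero_divisors R"
  have V: "?V \<subseteq> carrier R" and fin: "finite ?V"
    using assms(2) by (auto simp: nonzero_zero_divisors_def)
  have sub: "parcs (zero_divisor_graph R) \<subseteq> ?V \<times> ?V"
    by (auto simp: zero_divisor_graph_def)
  have "finite (parcs (zero_divisor_graph R))"
    by (rule finite_subset[OF sub]) (simp add: fin)
  moreover have "sym (parcs (zero_divisor_graph R))"
    using V by (auto simp: zero_divisor_graph_def sym_def m_comm subset_iff)
  ultimately show ?thesis
    using fin by unfold_locales (auto simp: zero_divisor_graph_def symmetric_def)
qed

definition same_prime_signature :: "nat \<Rightarrow> nat \<Rightarrow> bool" where
  "same_prime_signature m n \<longleftrightarrow>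
     (\<exists>\<sigma>. bij_betw \<sigma> (prime_factors n) (prime_factors m) \<and>
          (\<forall>p\<in>prime_factors n. multiplicity (\<sigma> p) m = multiplicity p n))"

end

theory Submission
  imports Defs
begin

text \<open>
  Whether \<open>u v = 0\<close> in \<open>\<int>\<^sub>n\<close> depends only on the exponents with which the primes dividing \<open>n\<close> occur
  in \<open>gcd u n\<close> and \<open>gcd v n\<close>. Hence exponents can be carried over between the product ring and
  \<open>\<int>\<close> modulo \<open>m\<^sub>1 \<cdots> m\<^sub>k\<close> (a product of the \<open>\<int>\<close> modulo \<open>m\<^sub>i\<close> by the Chinese remainder theorem), and
  there are maps of the two rings in both directions with \<open>u v = 0 \<longleftrightarrow> \<phi> u \<phi> v = 0\<close>. Such a map
  need not be injective, but two elements of a fibre are twins, so that the first zero-divisor graph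
  arises from an induced subgraph of the second by duplicating vertices into twins, adjacent or not.
  By Lovasz's replication lemma this preserves perfection.
\<close>

section \<open>Perfection and twins\<close>

text \<open>A clique \<open>C\<close> together with a colouring in \<open>card C\<close> colours
  certifies that the clique number and the chromatic number of \<open>T\<close> agree, so the graph
  arguments avoid \<open>Max\<close> and \<open>LEAST\<close>. \<open>P\<close> is consulted only at
  distinct elements; its diagonal stays free because \<open>u * u = 0\<close> may hold in a
  ring.\<close>

definition clique_colourable :: "('a \<Rightarrow> 'a \<Rightarrow> bool) \<Rightarrow> 'a set \<Rightarrow> bool" where
  "clique_colourable P T \<longleftrightarrow>
     (\<exists>C f. C \<subseteq> T \<and> pairwise P C \<and> f ` T \<subseteq> {..<card C} \<and>
        (\<forall>u\<in>T. \<forall>v\<in>T. u \<noteq> v \<and> P u v \<longrightarrow> f u \<noteq> (f v :: nat)))"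

definition perfect_on :: "'a set \<Rightarrow> ('a \<Rightarrow> 'a \<Rightarrow> bool) \<Rightarrow> bool" where
  "perfect_on V P \<longleftrightarrow> (\<forall>T\<subseteq>V. clique_colourable P T)"

lemma clique_colourableI:
  assumes "C \<subseteq> T" "pairwise P C" "f ` T \<subseteq> {..<card C}"
    "\<And>u v. \<lbrakk>u \<in> T; v \<in> T; u \<noteq> v; P u v\<rbrakk> \<Longrightarrow> f u \<noteq> (f v :: nat)"
  shows "clique_colourable P T"
  unfolding clique_colourable_def using assms by (intro exI[of _ C] exI[of _ f]) simp

lemma perfect_onE:
  assumes "perfect_on V P" "T \<subseteq> V"
  obtains C f where "C \<subseteq> T" "pairwise P C" "f ` T \<subseteq> {..<card C}"
    "\<And>u v. \<lbrakk>u \<in> T; v \<in> T; u \<noteq> v; P u v\<rbrakk> \<Longrightarrow> f u \<noteq> (f v :: nat)"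
proof -
  have "clique_colourable P T"
    using assms by (simp add: perfect_on_def)
  then show thesis
    unfolding clique_colourable_def by (elim exE conjE) (rule that, assumption+, blast)
qed

text \<open>A proper colouring is injective on a clique.\<close>

lemma card_clique_le_colours:
  assumes "pairwise P C" "C \<subseteq> T" "f ` T \<subseteq> {..<c::nat}"
    "\<And>u v. \<lbrakk>u \<in> T; v \<in> T; u \<noteq> v; P u v\<rbrakk> \<Longrightarrow> f u \<noteq> f v"
  shows "card C \<le> c"
proof -
  have "inj_on f C"
    using assms(1,2,4) unfolding inj_on_def pairwise_def by blast
  then show ?thesis
    using card_inj_on_le[of f C "{..<c}"] assms(2,3) by auto
qed

lemma perfect_on_inj:
  fixes V :: "'a set" and W :: "'b set"
  assumes "perfect_on W Q" "inj_on \<phi> V" "\<phi> ` V \<subseteq> W"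
    "\<And>u v. \<lbrakk>u \<in> V; v \<in> V; u \<noteq> v\<rbrakk> \<Longrightarrow> P u v \<longleftrightarrow> Q (\<phi> u) (\<phi> v)"
  shows "perfect_on V P"
  unfolding perfect_on_def
proof (intro allI impI)
  fix T assume T: "T \<subseteq> V"
  then have "\<phi> ` T \<subseteq> W" using assms(3) by blast
  then obtain C f where C: "C \<subseteq> \<phi> ` T" "pairwise Q C" and f: "f ` \<phi> ` T \<subseteq> {..<card C}"
    "\<And>u v. \<lbrakk>u \<in> \<phi> ` T; v \<in> \<phi> ` T; u \<noteq> v; Q u v\<rbrakk> \<Longrightarrow> f u \<noteq> (f v :: nat)"
    using perfect_onE[OF assms(1)] by metis
  obtain D where D: "D \<subseteq> T" "C = \<phi> ` D"
    using C(1) by (meson subset_imageE)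
  have inj: "inj_on \<phi> D" "inj_on \<phi> T"
    using assms(2) D(1) T inj_on_subset by blast+
  have "pairwise P D"
    using C(2) assms(4) D T inj unfolding pairwise_def inj_on_def by blast
  moreover have "card D = card C"
    using D(2) inj(1) by (simp add: card_image)
  moreover have "\<forall>u\<in>T. \<forall>v\<in>T. u \<noteq> v \<and> P u v \<longrightarrow> (f \<circ> \<phi>) u \<noteq> (f \<circ> \<phi>) v"
  proof (intro ballI impI; elim conjE)
    fix u v assume uv: "u \<in> T" "v \<in> T" "u \<noteq> v" "P u v"
    then have "Q (\<phi> u) (\<phi> v)" "\<phi> u \<noteq> \<phi> v"
      using assms(4) T inj(2) by (auto simp: inj_on_def)
    then show "(f \<circ> \<phi>) u \<noteq> (f \<circ> \<phi>) v"
      using f(2)[of "\<phi> u" "\<phi> v"] uv by simp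
  qed
  moreover have "(f \<circ> \<phi>) ` T \<subseteq> {..<card C}"
    using f(1) by (simp add: image_comp)
  ultimately show "clique_colourable P T"
    using D(1) by (intro clique_colourableI[of D T P "f \<circ> \<phi>"]) auto
qed

text \<open>Lovasz's replication lemma for both kinds of twins. By symmetry and the twin property at
  \<open>x\<close> and \<open>x'\<close>, the values of \<open>P\<close> on the four pairs from
  \<open>x\<close> and \<open>x'\<close> agree, so \<open>P x x\<close> decides whether the twins
  are adjacent.\<close>

lemma perfect_on_add_twin:
  fixes V :: "'a set"
  assumes fin: "finite V" and perf: "perfect_on (V - {x'}) P"
    and xV: "x \<in> V" and x'V: "x' \<in> V" and ne: "x \<noteq> x'"
    and sym: "\<And>u v. \<lbrakk>u \<in> V; v \<in> V; P u v\<rbrakk> \<Longrightarrow> P v u"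
    and twin: "\<And>w. w \<in> V \<Longrightarrow> P x w \<longleftrightarrow> P x' w"
  shows "perfect_on V P"
  unfolding perfect_on_def
proof (intro allI impI)
  fix T assume T: "T \<subseteq> V"
  have adj: "P x' w \<longleftrightarrow> P x w" "P w x' \<longleftrightarrow> P w x" if "w \<in> V" for w
    using twin[OF that] sym[OF xV that] sym[OF x'V that] sym[OF that xV] sym[OF that x'V]
    by blast+
  consider "x' \<notin> T" | "x' \<in> T" "x \<notin> T" | "x' \<in> T" "x \<in> T" by blast
  then show "clique_colourable P T"
  proof cases
    case 1
    then show ?thesis
      using perf T by (simp add: perfect_on_def subset_Diff_insert)
  next
    case 2
    \<comment> \<open>In the absence of \<open>x\<close>, its twin \<open>x'\<close> can be renamed
      to \<open>x\<close>, which turns \<open>T\<close> into a subset of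
      \<open>V - {x'}\<close>.\<close>
    have "perfect_on T P"
    proof (rule perfect_on_inj[OF perf])
      show "inj_on (\<lambda>u. if u = x' then x else u) T"
        using 2 by (auto simp: inj_on_def)
      show "(\<lambda>u. if u = x' then x else u) ` T \<subseteq> V - {x'}"
        using T xV ne by auto
      show "P u v \<longleftrightarrow> P (if u = x' then x else u) (if v = x' then x else v)"
        if "u \<in> T" "v \<in> T" "u \<noteq> v" for u v
      proof -
        have "u \<in> V" "v \<in> V" using that T by blast+
        then show ?thesis
          using adj that(3) by auto
      qed
    qed
    then show ?thesis
      by (simp add: perfect_on_def)
  next
    case 3
    define S where "S = T - {x'}"
    have S: "S \<subseteq> V - {x'}" "\<And>w. w \<in> S \<Longrightarrow> w \<in> V" "x \<in> S" "T = insert x' S"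
      "x' \<notin> S" "finite S"
      using T 3 ne fin finite_subset by (auto simp: S_def)
    obtain C f where C: "C \<subseteq> S" "pairwise P C" and f: "f ` S \<subseteq> {..<card C}"
      "\<And>u v. \<lbrakk>u \<in> S; v \<in> S; u \<noteq> v; P u v\<rbrakk> \<Longrightarrow> f u \<noteq> (f v :: nat)"
      using perfect_onE[OF perf S(1)] by metis
    show ?thesis
    proof (cases "P x x'")
      case False
      \<comment> \<open>Non-adjacent twins can share a colour, and \<open>C\<close> remains a clique
        of the right size.\<close>
      let ?g = "f(x' := f x)"
      have nP: "\<not> P x x" "\<not> P x' x"
        using False twin[of x] sym xV x'V by blast+
      have "?g u \<noteq> ?g v" if "u \<in> T" "v \<in> T" "u \<noteq> v" "P u v" for u v
        using that f(2)[of u v] f(2)[of x v] f(2)[of u x] adj[of u] adj[of v] S False nP by auto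
      moreover have "?g ` T \<subseteq> {..<card C}"
        using f(1) S by auto
      moreover have "C \<subseteq> T" using C(1) S(4) by blast
      ultimately show ?thesis
        using C(2) by (intro clique_colourableI[of C T P ?g])
    next
      case True
      have "P x x" using True twin[of x] sym xV x'V by blast
      show ?thesis
      \<comment> \<open>As \<open>S\<close> is coloured with \<open>card C\<close> colours, the
        cliques \<open>D\<close> of this cardinality are its maximum cliques. If one of them
        contains \<open>x\<close>, adding \<open>x'\<close> enlarges it, which pays for a new colour
        used by \<open>x'\<close> alone.\<close>
      proof (cases "\<exists>D\<subseteq>S. pairwise P D \<and> card D = card C \<and> x \<in> D")
        case True
        then obtain D where D: "D \<subseteq> S" "pairwise P D" "card D = card C" "x \<in> D" by blast
        let ?g = "f(x' := card C)"
        have "P x' w \<and> P w x'" if "w \<in> D" for w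
        proof -
          have "P x w \<and> P w x"
            using pairwiseD[OF D(2,4) that] pairwiseD[OF D(2) that D(4)] \<open>P x x\<close> by metis
          then show ?thesis
            using adj S(2) D(1) that by blast
        qed
        then have "pairwise P (insert x' D)"
          using D(2) by (auto simp: pairwise_insert)
        moreover have "card (insert x' D) = Suc (card C)"
          using D(1,3) S by (metis card_insert_disjoint finite_subset subsetD)
        moreover have "?g u \<noteq> ?g v" if "u \<in> T" "v \<in> T" "u \<noteq> v" "P u v" for u v
          using that f(2)[of u v] f(1) S(4) by auto
        moreover have "?g ` T \<subseteq> {..<Suc (card C)}"
          using f(1) S(4) by (auto simp: less_Suc_eq)
        moreover have "insert x' D \<subseteq> T" using D(1) S(4) by blast
        ultimately show ?thesis
          by (intro clique_colourableI[of "insert x' D" T P ?g]) simp_all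
      next
        case False
        \<comment> \<open>Removing from \<open>S\<close> the colour class \<open>X\<close> of \<open>x\<close>, except \<open>x\<close> itself, destroys all
           maximum cliques, since these use every colour and avoid \<open>x\<close>. This saves a colour, which is
           then given to the stable set \<open>insert x' (X - {x})\<close>.\<close>
        define X where "X = {y \<in> S. f y = f x}"
        define S' where "S' = S - (X - {x})"
        have "S' \<subseteq> V - {x'}" using S(1) by (auto simp: S'_def)
        then obtain D g where D: "D \<subseteq> S'" "pairwise P D" and g: "g ` S' \<subseteq> {..<card D}"
          "\<And>u v. \<lbrakk>u \<in> S'; v \<in> S'; u \<noteq> v; P u v\<rbrakk> \<Longrightarrow> g u \<noteq> (g v :: nat)"
          using perfect_onE[OF perf] by metis
        have DS: "D \<subseteq> S" using D(1) by (auto simp: S'_def)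
        have le: "card D \<le> card C"
          using card_clique_le_colours[OF D(2) DS f] by blast
        have "card D \<noteq> card C"
        proof
          assume eq: "card D = card C"
          have inj: "inj_on f D"
            using f(2) DS D(2) unfolding inj_on_def pairwise_def by blast
          have "f ` D = {..<card C}"
            using f(1) DS eq card_image[OF inj] by (intro card_subset_eq) auto
          then have "f x \<in> f ` D" using f(1) S(3) by blast
          then obtain y where y: "y \<in> D" "f y = f x" by auto
          then have "y = x" using D(1) DS by (auto simp: S'_def X_def)
          then show False using False y DS D(2) eq by blast
        qed
        then have lt: "card D < card C" using le by simp
        let ?g = "\<lambda>u. if u \<in> insert x' (X - {x}) then card D else g u"
        \<comment> \<open>Members of \<open>X\<close> other than \<open>x\<close> have the colour of
          \<open>x\<close>, so they are not adjacent to \<open>x\<close>, nor then to its twin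
          \<open>x'\<close>. The vertex \<open>x\<close> is left out because it is adjacent to
          \<open>x'\<close>.\<close>
        have Xx: "\<not> P u v" if "u \<in> insert x' (X - {x})" "v \<in> insert x' (X - {x})" "u \<noteq> v" for u v
          using that f(2)[of u v] adj[of u] adj[of v] f(2)[of x v] f(2)[of u x] S(2)[of u] S(2)[of v] S(3)
          by (auto simp: X_def)
        have mem: "u \<in> S'" if "u \<in> T" "u \<notin> insert x' (X - {x})" for u
          using that S(4) by (auto simp: S'_def)
        have "?g u \<noteq> ?g v" if "u \<in> T" "v \<in> T" "u \<noteq> v" "P u v" for u v
        proof (cases "u \<in> insert x' (X - {x})"; cases "v \<in> insert x' (X - {x})")
          assume "u \<in> insert x' (X - {x})" "v \<in> insert x' (X - {x})"
          then show ?thesis using Xx that by blast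
        next
          assume *: "u \<in> insert x' (X - {x})" "v \<notin> insert x' (X - {x})"
          then have "g v < card D" using mem[of v] that g(1) by blast
          with * show ?thesis by (simp only: if_True if_False)
        next
          assume *: "u \<notin> insert x' (X - {x})" "v \<in> insert x' (X - {x})"
          then have "g u < card D" using mem[of u] that g(1) by blast
          with * show ?thesis by (simp only: if_True if_False)
        next
          assume *: "u \<notin> insert x' (X - {x})" "v \<notin> insert x' (X - {x})"
          then have "g u \<noteq> g v" using mem that g(2) by blast
          with * show ?thesis by (simp only: if_False not_False_eq_True)
        qed
        moreover have "?g ` T \<subseteq> {..<card C}"
        proof (rule image_subsetI)
          fix u assume "u \<in> T"
          then have "?g u \<le> card D"
            using mem[of u] g(1) by (auto simp: image_subset_iff less_imp_le)
          then show "?g u \<in> {..<card C}" using lt by (simp only: lessThan_iff)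
        qed
        moreover have "C \<subseteq> T" using C(1) S(4) by blast
        ultimately show ?thesis
          using C(2) by (intro clique_colourableI[of C T P ?g])
      qed
    qed
  qed
qed

text \<open>Two elements with the same image under \<open>\<phi>\<close> are twins by
  \<open>pull\<close>. Deleting one of them repeatedly leads to an injective \<open>\<phi>\<close>,
  and the replication lemma restores the deleted elements.\<close>

lemma perfect_on_pullback:
  assumes perf: "perfect_on W Q" and fin: "finite V" and map: "\<phi> ` V \<subseteq> W"
    and sym: "\<And>u v. \<lbrakk>u \<in> V; v \<in> V; P u v\<rbrakk> \<Longrightarrow> P v u"
    and pull: "\<And>u v. \<lbrakk>u \<in> V; v \<in> V\<rbrakk> \<Longrightarrow> P u v \<longleftrightarrow> Q (\<phi> u) (\<phi> v)"
  shows "perfect_on V P"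
  using fin map sym pull
proof (induction V rule: finite_psubset_induct)
  case (psubset V)
  show ?case
  proof (cases "inj_on \<phi> V")
    case True
    show ?thesis
      by (rule perfect_on_inj[OF perf True psubset.prems(1)]) (simp add: psubset.prems(3))
  next
    case False
    then obtain x x' where x: "x \<in> V" "x' \<in> V" "x \<noteq> x'" "\<phi> x = \<phi> x'"
      by (auto simp: inj_on_def)
    have "perfect_on (V - {x'}) P"
      using psubset.prems x(2) by (intro psubset.IH) blast+
    then show ?thesis
      using psubset.prems x psubset.hyps by (intro perfect_on_add_twin[of V x' P x]) simp_all
  qed
qed

section \<open>From perfect graphs to perfect relations\<close>

text \<open>No clique exceeds the number of colours of a proper colouring, so a clique and a
  colouring of equal size are both optimal. Conversely, finiteness makes the minimum and the maximum
  attained.\<close>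

lemma chromatic_eq_clique_number_iff:
  assumes "finite (verts H)" and loopfree: "\<And>u. \<not> u \<rightarrow>\<^bsub>H\<^esub> u"
  shows "chromatic_number H = clique_number H \<longleftrightarrow>
    (\<exists>C f. clique H C \<and> proper_colouring H (card C) f)"
proof -
  let ?K = "{card C |C. clique H C}"
  have sub: "?K \<subseteq> {..card (verts H)}"
    using assms(1) by (auto simp: clique_def intro: card_mono)
  then have fin: "finite ?K" using finite_subset by blast
  have ne: "?K \<noteq> {}" by (auto simp: clique_def)
  have le: "card C \<le> c" if "clique H C" "proper_colouring H c f" for C c f
    using that by (intro card_clique_le_colours[of "\<lambda>u v. u \<rightarrow>\<^bsub>H\<^esub> v" C "verts H" f])
      (auto simp: clique_def proper_colouring_def pairwise_def)
  show ?thesis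
  proof
    assume eq: "chromatic_number H = clique_number H"
    \<comment> \<open>Giving every vertex its own colour shows that some colouring exists, so that
      \<open>LEAST\<close> denotes an attained value.\<close>
    obtain f where f: "bij_betw f (verts H) {0..<card (verts H)}"
      using ex_bij_betw_finite_nat[OF assms(1)] by blast
    have "f u \<noteq> f v" if "u \<in> verts H" "v \<in> verts H" "u \<rightarrow>\<^bsub>H\<^esub> v" for u v
      using inj_onD[OF bij_betw_imp_inj_on[OF f]] that loopfree by metis
    then have "proper_colouring H (card (verts H)) f"
      using bij_betw_imp_surj_on[OF f] by (simp add: proper_colouring_def atLeast0LessThan)
    then have "\<exists>f. proper_colouring H (chromatic_number H) f"
      unfolding chromatic_number_def by (rule LeastI[of "\<lambda>c. \<exists>f. proper_colouring H c f", OF exI])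
    moreover obtain C where "clique H C" "card C = clique_number H"
      using Max_in[OF fin ne] by (auto simp: clique_number_def)
    ultimately show "\<exists>C f. clique H C \<and> proper_colouring H (card C) f"
      using eq by metis
  next
    assume "\<exists>C f. clique H C \<and> proper_colouring H (card C) f"
    then obtain C f where C: "clique H C" "proper_colouring H (card C) f" by blast
    have "chromatic_number H = card C"
      unfolding chromatic_number_def using C le by (intro Least_equality) blast+
    moreover have "clique_number H = card C"
      unfolding clique_number_def using C le fin by (intro Max_eqI) blast+
    ultimately show "chromatic_number H = clique_number H" by simp
  qed
qed

text \<open>An induced subgraph is determined by its vertex set, so the quantifier over graphs
  \<open>H\<close> becomes one over subsets \<open>T\<close> of the vertices.\<close>

lemma perfect_graph_iff_perfect_on:
  fixes G :: "('a, 'b) pre_digraph"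
  assumes "graph G"
  shows "perfect_graph G \<longleftrightarrow> perfect_on (verts G) (\<lambda>u v. u \<rightarrow>\<^bsub>G\<^esub> v)"
proof -
  interpret graph G by fact
  have loopfree: "\<not> u \<rightarrow>\<^bsub>G\<^esub> u" for u
    using no_loops by (auto simp: arcs_ends_def arc_to_ends_def)
  have dom: "u \<rightarrow>\<^bsub>G \<restriction> T\<^esub> v \<longleftrightarrow> u \<in> T \<and> v \<in> T \<and> u \<rightarrow>\<^bsub>G\<^esub> v" for T u v
    by (auto simp: arcs_ends_def arc_to_ends_def induce_subgraph_def)
  have "perfect_graph G \<longleftrightarrow>
      (\<forall>T\<subseteq>verts G. chromatic_number (G \<restriction> T) = clique_number (G \<restriction> T))"
  proof
    assume "perfect_graph G"
    then show "\<forall>T\<subseteq>verts G. chromatic_number (G \<restriction> T) = clique_number (G \<restriction> T)"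
      using induced_induce unfolding perfect_graph_def by blast
  next
    assume *: "\<forall>T\<subseteq>verts G. chromatic_number (G \<restriction> T) = clique_number (G \<restriction> T)"
    show "perfect_graph G"
      unfolding perfect_graph_def
    proof (intro allI impI)
      fix H assume H: "induced_subgraph H G"
      then have "verts H \<subseteq> verts G"
        by (simp add: induced_subgraph_def subgraph_def)
      with * have "chromatic_number (G \<restriction> verts H) = clique_number (G \<restriction> verts H)"
        by blast
      then show "chromatic_number H = clique_number H"
        by (simp add: induce_eq_iff_induced[OF H])
    qed
  qed
  also have "\<dots> \<longleftrightarrow> (\<forall>T\<subseteq>verts G. \<exists>C f. clique (G \<restriction> T) C \<and> proper_colouring (G \<restriction> T) (card C) f)"
    using chromatic_eq_clique_number_iff[of "G \<restriction> _"] dom loopfree finite_verts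
    by (metis finite_subset induce_subgraph_verts)
  also have "\<dots> \<longleftrightarrow> perfect_on (verts G) (\<lambda>u v. u \<rightarrow>\<^bsub>G\<^esub> v)"
    unfolding perfect_on_def
  proof (intro arg_cong[where f=All] ext imp_cong refl)
    fix T :: "'a set" assume "T \<subseteq> verts G"
    have "clique (G \<restriction> T) C \<and> proper_colouring (G \<restriction> T) (card C) f \<longleftrightarrow>
        C \<subseteq> T \<and> pairwise (\<lambda>u v. u \<rightarrow>\<^bsub>G\<^esub> v) C \<and> f ` T \<subseteq> {..<card C} \<and>
        (\<forall>u\<in>T. \<forall>v\<in>T. u \<noteq> v \<and> u \<rightarrow>\<^bsub>G\<^esub> v \<longrightarrow> f u \<noteq> f v)" for C f
      unfolding clique_def proper_colouring_def pairwise_def dom induce_subgraph_verts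
      using loopfree by (auto 0 3)
    then show "(\<exists>C f. clique (G \<restriction> T) C \<and> proper_colouring (G \<restriction> T) (card C) f) =
        clique_colourable (\<lambda>u v. u \<rightarrow>\<^bsub>G\<^esub> v) T"
      by (simp add: clique_colourable_def)
  qed
  finally show ?thesis .
qed

text \<open>Dropping the condition \<open>u \<noteq> v\<close> of the arcs changes the relation on
  the diagonal only. The resulting pure zero-product relation can be pulled back along maps that
  identify vertices.\<close>

lemma perfect_zero_divisor_graph_iff:
  assumes "cring R" "finite (carrier R)"
  shows "perfect_graph (with_proj (zero_divisor_graph R)) \<longleftrightarrow>
    perfect_on (nonzero_zero_divisors R) (\<lambda>u v. u \<otimes>\<^bsub>R\<^esub> v = \<zero>\<^bsub>R\<^esub>)"
proof -
  interpret pair_graph "zero_divisor_graph R"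
    using assms by (rule pair_graph_zero_divisor_graph)
  have "perfect_graph (with_proj (zero_divisor_graph R)) \<longleftrightarrow>
    perfect_on (nonzero_zero_divisors R) (\<lambda>u v. (u, v) \<in> parcs (zero_divisor_graph R))"
    using perfect_graph_iff_perfect_on[OF graph_axioms] by (simp add: zero_divisor_graph_def)
  also have "\<dots> \<longleftrightarrow> perfect_on (nonzero_zero_divisors R) (\<lambda>u v. u \<otimes>\<^bsub>R\<^esub> v = \<zero>\<^bsub>R\<^esub>)"
    by (intro iffI; erule perfect_on_inj[where \<phi>=id]) (auto simp: zero_divisor_graph_def)
  finally show ?thesis .
qed

text \<open>A map that preserves and reflects zero products sends vertices to vertices, and then
  \<open>perfect_on_pullback\<close> applies to it.\<close>

lemma perfect_zero_divisor_graph_pullback: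
  assumes R: "cring R" "finite (carrier R)" and S: "cring S" "finite (carrier S)"
    and map: "\<phi> ` carrier R \<subseteq> carrier S"
    and pull: "\<And>u v. \<lbrakk>u \<in> carrier R; v \<in> carrier R\<rbrakk> \<Longrightarrow>
      u \<otimes>\<^bsub>R\<^esub> v = \<zero>\<^bsub>R\<^esub> \<longleftrightarrow> \<phi> u \<otimes>\<^bsub>S\<^esub> \<phi> v = \<zero>\<^bsub>S\<^esub>"
    and perf: "perfect_graph (with_proj (zero_divisor_graph S))"
  shows "perfect_graph (with_proj (zero_divisor_graph R))"
proof -
  interpret R: cring R by fact
  interpret S: cring S by fact
  \<comment> \<open>If \<open>\<phi> u\<close> were zero, so would be its product with
    \<open>\<phi>\<close> of the unit; reflecting this gives that \<open>u\<close> times the unit is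
    zero.\<close>
  have nz: "\<phi> u \<noteq> \<zero>\<^bsub>S\<^esub>" if "u \<in> carrier R" "u \<noteq> \<zero>\<^bsub>R\<^esub>" for u
  proof -
    have "\<phi> \<one>\<^bsub>R\<^esub> \<in> carrier S" using map R.one_closed by blast
    then show ?thesis
      using that pull[of u "\<one>\<^bsub>R\<^esub>"] S.l_null[of "\<phi> \<one>\<^bsub>R\<^esub>"] by auto
  qed
  have "\<phi> u \<in> nonzero_zero_divisors S" if "u \<in> nonzero_zero_divisors R" for u
    using that nz pull map unfolding nonzero_zero_divisors_def by blast
  then have "perfect_on (nonzero_zero_divisors R) (\<lambda>u v. u \<otimes>\<^bsub>R\<^esub> v = \<zero>\<^bsub>R\<^esub>)"
    using perf R(2) pull unfolding perfect_zero_divisor_graph_iff[OF S]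
    by (elim perfect_on_pullback) (auto simp: nonzero_zero_divisors_def R.m_comm)
  then show ?thesis
    by (simp add: perfect_zero_divisor_graph_iff[OF R])
qed

section \<open>Prime signatures\<close>

lemma same_prime_signature_sym:
  assumes "same_prime_signature m n" shows "same_prime_signature n m"
proof -
  obtain \<sigma> where \<sigma>: "bij_betw \<sigma> (prime_factors n) (prime_factors m)"
      "\<forall>p\<in>prime_factors n. multiplicity (\<sigma> p) m = multiplicity p n"
    using assms unfolding same_prime_signature_def by blast
  let ?\<tau> = "inv_into (prime_factors n) \<sigma>"
  have "multiplicity (?\<tau> q) n = multiplicity q m" if "q \<in> prime_factors m" for q
    using \<sigma> that by (metis bij_betw_def bij_betw_inv_into_right inv_into_into)
  then show ?thesis
    using bij_betw_inv_into[OF \<sigma>(1)] unfolding same_prime_signature_def by blast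
qed

text \<open>Every prime outside \<open>prime_factors n\<close> has multiplicity 0 in
  \<open>n\<close>.\<close>

lemma dvd_iff_multiplicity_prime_factors:
  fixes n d :: nat
  assumes "n > 0" "d > 0"
  shows "n dvd d \<longleftrightarrow> (\<forall>p\<in>prime_factors n. multiplicity p n \<le> multiplicity p d)"
proof
  assume "n dvd d"
  then show "\<forall>p\<in>prime_factors n. multiplicity p n \<le> multiplicity p d"
    using assms by (auto intro: dvd_imp_multiplicity_le)
next
  assume *: "\<forall>p\<in>prime_factors n. multiplicity p n \<le> multiplicity p d"
  have "multiplicity p n \<le> multiplicity p d" if "prime p" for p
    using * that by (cases "p \<in> prime_factors n") (auto simp: prime_factors_multiplicity)
  then show "n dvd d"
    using assms by (intro multiplicity_le_imp_dvd) auto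
qed

text \<open>For positive \<open>n\<close> this replaces the factors by positive numbers.
  Multiplicities then describe divisibility even when \<open>x\<close> or \<open>y\<close> is 0,
  where \<open>multiplicity\<close> has the default value 0.\<close>

lemma dvd_mult_iff_dvd_gcd_mult:
  fixes n x y :: nat
  shows "n dvd x * y \<longleftrightarrow> n dvd gcd x n * gcd y n"
proof
  assume "n dvd x * y"
  \<comment> \<open>The right-hand side is the gcd of \<open>y * x\<close> and \<open>y * n\<close>,
    both multiples of \<open>n\<close>; the same argument then treats \<open>y\<close>.\<close>
  then have "n dvd y * gcd x n"
    by (subst gcd_mult_distrib_nat) (simp add: mult.commute)
  then show "n dvd gcd x n * gcd y n"
    by (subst gcd_mult_distrib_nat) (simp add: mult.commute)
next
  assume "n dvd gcd x n * gcd y n"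
  moreover have "gcd x n * gcd y n dvd x * y" by (intro mult_dvd_mono) auto
  ultimately show "n dvd x * y" by (rule dvd_trans)
qed

text \<open>The map takes \<open>gcd x n\<close> and moves its exponents along the bijection of
  primes. Exponents add under multiplication on both sides, and the thresholds set by
  \<open>n\<close> and \<open>m\<close> correspond.\<close>

lemma same_prime_signature_imp_zero_product_map:
  fixes m n :: nat
  assumes "m > 0" "n > 0" "same_prime_signature m n"
  obtains \<theta> :: "nat \<Rightarrow> nat"
  where "\<And>x y. n dvd x * y \<longleftrightarrow> m dvd \<theta> x * \<theta> y"
proof -
  obtain \<sigma> where \<sigma>: "bij_betw \<sigma> (prime_factors n) (prime_factors m)"
      "\<forall>p\<in>prime_factors n. multiplicity (\<sigma> p) m = multiplicity p n"
    using assms unfolding same_prime_signature_def by blast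
  \<comment> \<open>\<open>\<psi> d\<close> carries the exponent of \<open>d\<close> at each prime
    \<open>p\<close> of \<open>n\<close> over to the prime \<open>\<sigma> p\<close> of
    \<open>m\<close>.\<close>
  define \<psi> where "\<psi> d = (\<Prod>p\<in>prime_factors n. \<sigma> p ^ multiplicity p d)" for d :: nat
  have prm: "prime (\<sigma> p)" if "p \<in> prime_factors n" for p
    using \<sigma>(1) that bij_betwE by (metis in_prime_factors_imp_prime)
  have pos: "\<psi> d > 0" for d
    unfolding \<psi>_def using prm by (intro prod_pos) (simp add: prime_gt_0_nat)
  \<comment> \<open>Since \<open>\<sigma>\<close> is injective with prime values, only the factor
    indexed by \<open>p\<close> contributes.\<close>
  have mult_\<psi>: "multiplicity (\<sigma> p) (\<psi> d) = multiplicity p d" if p: "p \<in> prime_factors n" for p d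
  proof -
    have "multiplicity (\<sigma> p) (\<psi> d) =
        (\<Sum>q\<in>prime_factors n. multiplicity (\<sigma> p) (\<sigma> q ^ multiplicity q d))"
      unfolding \<psi>_def using prm p by (intro prime_elem_multiplicity_prod_distrib)
        (auto simp: image_iff dest: prm prime_gt_0_nat)
    also have "\<dots> = (\<Sum>q\<in>prime_factors n. if q = p then multiplicity p d else 0)"
    proof (intro sum.cong refl)
      fix q assume q: "q \<in> prime_factors n"
      have "\<sigma> q = \<sigma> p \<longleftrightarrow> q = p"
        using \<sigma>(1) p q by (auto simp: bij_betw_def inj_on_def)
      then show "multiplicity (\<sigma> p) (\<sigma> q ^ multiplicity q d) = (if q = p then multiplicity p d else 0)"
        using prm[OF p] prm[OF q]
        by (auto simp: multiplicity_distinct_prime_power)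
    qed
    also have "\<dots> = multiplicity p d" using p by simp
    finally show ?thesis .
  qed
  have dvd: "n dvd d * e \<longleftrightarrow> m dvd \<psi> d * \<psi> e" if "d > 0" "e > 0" for d e
  proof -
    have "m dvd \<psi> d * \<psi> e \<longleftrightarrow>
        (\<forall>p\<in>prime_factors n. multiplicity (\<sigma> p) m \<le> multiplicity (\<sigma> p) (\<psi> d * \<psi> e))"
      using dvd_iff_multiplicity_prime_factors[OF assms(1), of "\<psi> d * \<psi> e"] pos
        bij_betw_imp_surj_on[OF \<sigma>(1), symmetric]
      by simp
    also have "\<dots> \<longleftrightarrow> (\<forall>p\<in>prime_factors n. multiplicity p n \<le> multiplicity p (d * e))"
    proof (intro ball_cong refl)
      fix p assume p: "p \<in> prime_factors n"
      have "multiplicity (\<sigma> p) (\<psi> d * \<psi> e) = multiplicity p d + multiplicity p e"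
        using pos prm[OF p] mult_\<psi>[OF p]
        by (subst prime_elem_multiplicity_mult_distrib) (auto simp: less_imp_neq)
      also have "\<dots> = multiplicity p (d * e)"
        using that p by (subst prime_elem_multiplicity_mult_distrib) auto
      finally show "(multiplicity (\<sigma> p) m \<le> multiplicity (\<sigma> p) (\<psi> d * \<psi> e)) =
          (multiplicity p n \<le> multiplicity p (d * e))"
        using \<sigma>(2) p by simp
    qed
    also have "\<dots> \<longleftrightarrow> n dvd d * e"
      using dvd_iff_multiplicity_prime_factors[OF assms(2), of "d * e"] that by simp
    finally show ?thesis by simp
  qed
  have "n dvd x * y \<longleftrightarrow> m dvd \<psi> (gcd x n) * \<psi> (gcd y n)" for x y
    using dvd[of "gcd x n" "gcd y n"] dvd_mult_iff_dvd_gcd_mult[of n x y] assms(2) by simp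
  then show ?thesis using that[of "\<lambda>x. \<psi> (gcd x n)"] by blast
qed

section \<open>Construction of pairwise coprime moduli with prescribed signatures\<close>

lemma same_prime_signature_transport:
  fixes n :: nat
  assumes "inj_on g (prime_factors n)" "\<And>p. p \<in> prime_factors n \<Longrightarrow> prime (g p)"
  shows "same_prime_signature (\<Prod>p\<in>prime_factors n. g p ^ multiplicity p n) n"
proof -
  \<comment> \<open>Reindexing by the new primes gives the form (product of \<open>q ^ ?h q\<close>
    over a set of primes) from which multiplicities can be read off.\<close>
  let ?h = "\<lambda>q. multiplicity (inv_into (prime_factors n) g q) n"
  let ?m = "\<Prod>p\<in>prime_factors n. g p ^ multiplicity p n"
  have m: "?m = (\<Prod>q\<in>g ` prime_factors n. q ^ ?h q)"
    using assms(1) by (simp add: prod.reindex)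
  have mult: "multiplicity (g p) ?m = multiplicity p n" if "p \<in> prime_factors n" for p
    unfolding m using assms that by (subst multiplicity_prod_prime_powers) auto
  have "prime_factors ?m = g ` prime_factors n"
  proof (intro equalityI subsetI)
    fix q assume q: "q \<in> prime_factors ?m"
    then have "q \<in> g ` prime_factors n \<or> multiplicity q ?m = 0"
      unfolding m using assms(2) by (subst multiplicity_prod_prime_powers) auto
    then show "q \<in> g ` prime_factors n"
      using q by (auto simp: prime_factors_multiplicity)
  next
    fix q assume "q \<in> g ` prime_factors n"
    then show "q \<in> prime_factors ?m"
      using mult assms(2) by (auto simp: prime_factors_multiplicity[of ?m])
        (auto simp: prime_factors_multiplicity)
  qed
  then show ?thesis
    unfolding same_prime_signature_def using assms(1) mult
    by (intro exI[of _ g]) (auto simp: bij_betw_def)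
qed

text \<open>As there are infinitely many primes, each pair of an index \<open>i\<close> and a number
  \<open>p\<close> can receive a prime of its own, so different indices use disjoint sets of
  primes.\<close>

lemma ex_coprime_same_prime_signature:
  fixes n :: "nat \<Rightarrow> nat"
  obtains m where "\<And>i. i \<in> I \<Longrightarrow> m i > 0"
    "\<And>i j. \<lbrakk>i \<in> I; j \<in> I; i \<noteq> j\<rbrakk> \<Longrightarrow> coprime (m i) (m j)"
    "\<And>i. i \<in> I \<Longrightarrow> same_prime_signature (m i) (n i)"
proof -
  \<comment> \<open>\<open>prod_encode\<close> numbers the pairs injectively, and
    \<open>enumerate\<close> is strictly increasing on the primes.\<close>
  define g where "g i p = enumerate {q::nat. prime q} (prod_encode (i, p))" for i p
  have prm: "prime (g i p)" for i p
    unfolding g_def using enumerate_in_set[OF primes_infinite] by simp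
  have inj: "g i p = g j q \<longleftrightarrow> i = j \<and> p = q" for i j p q
    unfolding g_def
    using strict_mono_eq[OF strict_mono_enumerate[OF primes_infinite]] by simp
  let ?m = "\<lambda>i. \<Prod>p\<in>prime_factors (n i). g i p ^ multiplicity p (n i)"
  have "?m i > 0" for i
    using prm by (intro prod_pos) (simp add: prime_gt_0_nat)
  moreover have "coprime (?m i) (?m j)" if "i \<noteq> j" for i j
    using that prm inj by (intro prod_coprime_left prod_coprime_right)
      (auto intro!: primes_coprime simp: coprime_power_left_iff coprime_power_right_iff)
  moreover have "same_prime_signature (?m i) (n i)" if "i \<in> I" for i
    using prm inj by (intro same_prime_signature_transport) (auto simp: inj_on_def)
  ultimately show ?thesis using that[of ?m] by blast
qed

section \<open>Products of residue rings\<close>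

lemma RDirProd_list_mult_nth:
  assumes "xs \<in> carrier (RDirProd_list Rs)" "ys \<in> carrier (RDirProd_list Rs)"
  shows "length (xs \<otimes>\<^bsub>RDirProd_list Rs\<^esub> ys) = length Rs"
    and "i < length Rs \<Longrightarrow>
      (xs \<otimes>\<^bsub>RDirProd_list Rs\<^esub> ys) ! i = xs ! i \<otimes>\<^bsub>Rs ! i\<^esub> ys ! i"
proof -
  have "length (xs \<otimes>\<^bsub>RDirProd_list Rs\<^esub> ys) = length Rs \<and>
    (\<forall>i<length Rs. (xs \<otimes>\<^bsub>RDirProd_list Rs\<^esub> ys) ! i = xs ! i \<otimes>\<^bsub>Rs ! i\<^esub> ys ! i)"
    using assms
  proof (induction Rs arbitrary: xs ys)
    case Nil
    then show ?case by (simp add: monoid.defs)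
  next
    case (Cons R Rs)
    then obtain a as b bs where eq: "xs = a # as" "ys = b # bs"
      and mem: "a \<in> carrier R" "as \<in> carrier (RDirProd_list Rs)"
        "b \<in> carrier R" "bs \<in> carrier (RDirProd_list Rs)"
      by (auto simp: RDirProd_list_carrier)
    have "xs \<otimes>\<^bsub>RDirProd_list (R # Rs)\<^esub> ys =
        (a \<otimes>\<^bsub>R\<^esub> b) # (as \<otimes>\<^bsub>RDirProd_list Rs\<^esub> bs)"
      \<comment> \<open>Prepending a component is multiplicative on pairs of a head and a tail,
        which splits the list product into its head and a product of tails.\<close>
      using ring_hom_mult[OF RDirProd_list_hom1, of "(a, as)" R Rs "(b, bs)"] mem
      by (simp add: eq RDirProd_carrier) (simp add: RDirProd_def DirProd_def monoid.defs)
    then show ?case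
      using Cons.IH[OF mem(2,4)] by (auto simp: eq nth_Cons split: nat.split)
  qed
  then show "length (xs \<otimes>\<^bsub>RDirProd_list Rs\<^esub> ys) = length Rs"
    "i < length Rs \<Longrightarrow> (xs \<otimes>\<^bsub>RDirProd_list Rs\<^esub> ys) ! i = xs ! i \<otimes>\<^bsub>Rs ! i\<^esub> ys ! i"
    by auto
qed

lemma RDirProd_list_zero_nth:
  "length \<zero>\<^bsub>RDirProd_list Rs\<^esub> = length Rs"
  "i < length Rs \<Longrightarrow> \<zero>\<^bsub>RDirProd_list Rs\<^esub> ! i = \<zero>\<^bsub>Rs ! i\<^esub>"
proof -
  have "\<zero>\<^bsub>RDirProd_list Rs\<^esub> = map zero Rs"
    unfolding RDirProd_list_zero by (induction Rs) auto
  then show "length \<zero>\<^bsub>RDirProd_list Rs\<^esub> = length Rs"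
    "i < length Rs \<Longrightarrow> \<zero>\<^bsub>RDirProd_list Rs\<^esub> ! i = \<zero>\<^bsub>Rs ! i\<^esub>"
    by simp_all
qed

lemma RDirProd_list_mult_eq_zero_iff:
  assumes "xs \<in> carrier (RDirProd_list Rs)" "ys \<in> carrier (RDirProd_list Rs)"
  shows "xs \<otimes>\<^bsub>RDirProd_list Rs\<^esub> ys = \<zero>\<^bsub>RDirProd_list Rs\<^esub> \<longleftrightarrow>
    (\<forall>i<length Rs. xs ! i \<otimes>\<^bsub>Rs ! i\<^esub> ys ! i = \<zero>\<^bsub>Rs ! i\<^esub>)"
  using RDirProd_list_mult_nth[OF assms] RDirProd_list_zero_nth[where Rs = Rs]
  by (auto simp: list_eq_iff_nth_eq)

lemma RDirProd_list_cring:
  assumes "\<And>R. R \<in> set Rs \<Longrightarrow> cring R"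
  shows "cring (RDirProd_list Rs)"
proof -
  have nth: "cring (Rs ! i)" if "i < length Rs" for i
    using assms that by simp
  interpret ring "RDirProd_list Rs"
    using nth by (intro RDirProd_list_is_ring) (simp add: cring_def)
  have "xs \<otimes>\<^bsub>RDirProd_list Rs\<^esub> ys = ys \<otimes>\<^bsub>RDirProd_list Rs\<^esub> xs"
    if xs: "xs \<in> carrier (RDirProd_list Rs)" and ys: "ys \<in> carrier (RDirProd_list Rs)" for xs ys
  proof (rule nth_equalityI)
    show "length (xs \<otimes>\<^bsub>RDirProd_list Rs\<^esub> ys) = length (ys \<otimes>\<^bsub>RDirProd_list Rs\<^esub> xs)"
      using RDirProd_list_mult_nth(1) xs ys by metis
    fix i assume "i < length (xs \<otimes>\<^bsub>RDirProd_list Rs\<^esub> ys)"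
    then have i: "i < length Rs"
      using RDirProd_list_mult_nth(1)[OF xs ys] by simp
    show "(xs \<otimes>\<^bsub>RDirProd_list Rs\<^esub> ys) ! i = (ys \<otimes>\<^bsub>RDirProd_list Rs\<^esub> xs) ! i"
      using RDirProd_list_carrier_mem(2)[OF xs i] RDirProd_list_carrier_mem(2)[OF ys i]
        cring.cring_simprules(14)[OF nth[OF i]]
      by (simp add: RDirProd_list_mult_nth(2)[OF _ _ i] xs ys)
  qed
  then show ?thesis
    by (intro cring.intro monoid_comm_monoidI ring_axioms)
qed

lemma RDirProd_list_finite_carrier:
  assumes "\<And>R. R \<in> set Rs \<Longrightarrow> finite (carrier R)"
  shows "finite (carrier (RDirProd_list Rs))"
  using assms by (induction Rs) (auto simp: RDirProd_list_carrier)

lemma residue_ring_cring: "m > 1 \<Longrightarrow> cring (residue_ring m)"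
  by (rule residues.cring) (simp add: residues_def)

lemma prod_dvd_iff_coprime:
  fixes m :: "'a \<Rightarrow> nat"
  assumes "finite A" "\<And>i j. \<lbrakk>i \<in> A; j \<in> A; i \<noteq> j\<rbrakk> \<Longrightarrow> coprime (m i) (m j)"
  shows "(\<Prod>i\<in>A. m i) dvd d \<longleftrightarrow> (\<forall>i\<in>A. m i dvd d)"
proof
  show "(\<Prod>i\<in>A. m i) dvd d \<Longrightarrow> \<forall>i\<in>A. m i dvd d"
    using assms(1) by (meson dvd_prodI dvd_trans)
next
  assume "\<forall>i\<in>A. m i dvd d"
  then show "(\<Prod>i\<in>A. m i) dvd d"
    using cong_cong_prod_coprime_nat[of A d 0 m] assms(2) by (simp add: cong_0_iff)
qed

text \<open>Moves from integer residues to natural numbers, on which the exponent maps are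
  defined.\<close>

lemma residue_ring_mult_eq_zero_iff:
  assumes "x \<ge> 0" "y \<ge> 0"
  shows "x \<otimes>\<^bsub>residue_ring (int m)\<^esub> y = \<zero>\<^bsub>residue_ring (int m)\<^esub> \<longleftrightarrow> m dvd nat x * nat y"
  using assms
  by (simp add: residue_ring_def flip: dvd_eq_mod_eq_0 nat_mult_distrib int_dvd_int_iff)

section \<open>Comparison of the product ring with the residue ring of the product\<close>

context
  fixes k :: nat and n m :: "nat \<Rightarrow> nat"
  assumes k: "k \<ge> 1" and n: "\<And>i. i < k \<Longrightarrow> n i \<ge> 2" and m: "\<And>i. i < k \<Longrightarrow> m i > 0"
    and coprime_m: "\<And>i j. \<lbrakk>i < k; j < k; i \<noteq> j\<rbrakk> \<Longrightarrow> coprime (m i) (m j)"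
    and signature: "\<And>i. i < k \<Longrightarrow> same_prime_signature (m i) (n i)"
begin

abbreviation (input) "prod_ring \<equiv> RDirProd_list (map (\<lambda>i. residue_ring (int (n i))) [0..<k])"
abbreviation (input) "residue_prod \<equiv> residue_ring (int (\<Prod>i<k. m i))"

text \<open>\<open>n 0\<close> has a prime factor, and the signature passes it on to
  \<open>m 0\<close>. A modulus above 1 makes \<open>residue_ring_cring\<close> applicable.\<close>

lemma one_less_prod_m: "1 < (\<Prod>i<k. m i)"
proof -
  have "prime_factors (n 0) \<noteq> {}"
    using n[of 0] k by (auto simp: prime_factorization_empty_iff)
  then have "prime_factors (m 0) \<noteq> {}"
    using signature[of 0] k unfolding same_prime_signature_def bij_betw_def by auto
  then have "m 0 > 1"
    using m[of 0] k by (cases "m 0 = 1") auto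
  moreover have "m 0 dvd (\<Prod>i<k. m i)" using k by (intro dvd_prodI) auto
  moreover have "(\<Prod>i<k. m i) > 0" using m by (intro prod_pos) auto
  ultimately show ?thesis by (meson dvd_imp_le less_le_trans)
qed

lemma product_cring: "cring prod_ring" and product_finite: "finite (carrier prod_ring)"
proof -
  show "cring prod_ring"
    using n by (intro RDirProd_list_cring) (force intro!: residue_ring_cring)
  show "finite (carrier prod_ring)"
    by (intro RDirProd_list_finite_carrier) (auto simp: residue_ring_def)
qed

lemma residue_prod_cring: "cring residue_prod" and residue_prod_finite: "finite (carrier residue_prod)"
proof -
  show "cring residue_prod"
    by (rule residue_ring_cring) (use one_less_prod_m in linarith)
  show "finite (carrier residue_prod)"
    by (simp add: residue_ring_def)
qed

lemma product_mult_eq_zero_iff: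
  assumes "xs \<in> carrier prod_ring" "ys \<in> carrier prod_ring"
  shows "xs \<otimes>\<^bsub>prod_ring\<^esub> ys = \<zero>\<^bsub>prod_ring\<^esub> \<longleftrightarrow> (\<forall>i<k. n i dvd nat (xs ! i) * nat (ys ! i))"
proof -
  have "xs ! i \<ge> 0" "ys ! i \<ge> 0" if "i < k" for i
    using RDirProd_list_carrier_mem(2)[OF assms(1), of i]
      RDirProd_list_carrier_mem(2)[OF assms(2), of i] that
    by (auto simp: residue_ring_def)
  then show ?thesis
    using RDirProd_list_mult_eq_zero_iff[OF assms] by (simp add: residue_ring_mult_eq_zero_iff)
qed

text \<open>Pairwise coprimality splits divisibility by the product into divisibility by every
  \<open>m i\<close>. The criterion thus takes the shape of
  \<open>product_mult_eq_zero_iff\<close>.\<close>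

lemma residue_prod_mult_eq_zero_iff:
  assumes "x \<in> carrier residue_prod" "y \<in> carrier residue_prod"
  shows "x \<otimes>\<^bsub>residue_prod\<^esub> y = \<zero>\<^bsub>residue_prod\<^esub> \<longleftrightarrow> (\<forall>i<k. m i dvd nat x * nat y)"
proof -
  have "x \<ge> 0" "y \<ge> 0" using assms by (auto simp: residue_ring_def)
  then show ?thesis
    using prod_dvd_iff_coprime[of "{..<k}" m "nat x * nat y"] coprime_m
    by (simp only: residue_ring_mult_eq_zero_iff) auto
qed

lemma perfect_residue_prod_if_perfect_product:
  assumes "perfect_graph (with_proj (zero_divisor_graph prod_ring))"
  shows "perfect_graph (with_proj (zero_divisor_graph residue_prod))"
proof -
  \<comment> \<open>The map leads from \<open>m i\<close> to \<open>n i\<close> here, hence the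
    symmetry of the signature relation.\<close>
  have "\<exists>\<theta>. \<forall>x y. m i dvd x * y \<longleftrightarrow> n i dvd \<theta> x * \<theta> y" if i: "i < k" for i
    using same_prime_signature_imp_zero_product_map[of "n i" "m i"] n[OF i] m[OF i]
      same_prime_signature_sym[OF signature[OF i]] by (metis gr0I not_numeral_le_zero)
  then obtain \<theta> where \<theta>: "\<And>i x y. i < k \<Longrightarrow> m i dvd x * y \<longleftrightarrow> n i dvd \<theta> i x * \<theta> i y"
    by metis
  \<comment> \<open>Reduction modulo \<open>n i\<close> brings the value into the carrier and leaves
    divisibility of products by \<open>n i\<close> unchanged.\<close>
  let ?\<phi> = "\<lambda>x. map (\<lambda>i. int (\<theta> i (nat x) mod n i)) [0..<k]"
  have mem: "?\<phi> x \<in> carrier prod_ring" for x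
    using n by (intro RDirProd_list_carrier_memI) (force simp: residue_ring_def)+
  show ?thesis
  proof (rule perfect_zero_divisor_graph_pullback[OF residue_prod_cring residue_prod_finite
        product_cring product_finite _ _ assms])
    show "?\<phi> ` carrier residue_prod \<subseteq> carrier prod_ring" using mem by blast
    fix u v assume "u \<in> carrier residue_prod" "v \<in> carrier residue_prod"
    then have "u \<otimes>\<^bsub>residue_prod\<^esub> v = \<zero>\<^bsub>residue_prod\<^esub> \<longleftrightarrow> (\<forall>i<k. n i dvd \<theta> i (nat u) * \<theta> i (nat v))"
      by (subst residue_prod_mult_eq_zero_iff) (auto simp: \<theta>)
    also have "\<dots> \<longleftrightarrow> ?\<phi> u \<otimes>\<^bsub>prod_ring\<^esub> ?\<phi> v = \<zero>\<^bsub>prod_ring\<^esub>"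
      by (simp add: product_mult_eq_zero_iff[OF mem mem] dvd_eq_mod_eq_0 mod_mult_eq)
    finally show "u \<otimes>\<^bsub>residue_prod\<^esub> v = \<zero>\<^bsub>residue_prod\<^esub> \<longleftrightarrow> ?\<phi> u \<otimes>\<^bsub>prod_ring\<^esub> ?\<phi> v = \<zero>\<^bsub>prod_ring\<^esub>" .
  qed
qed

lemma perfect_product_if_perfect_residue_prod:
  assumes "perfect_graph (with_proj (zero_divisor_graph residue_prod))"
  shows "perfect_graph (with_proj (zero_divisor_graph prod_ring))"
proof -
  have "\<exists>\<theta>. \<forall>x y. n i dvd x * y \<longleftrightarrow> m i dvd \<theta> x * \<theta> y" if i: "i < k" for i
    using same_prime_signature_imp_zero_product_map[of "m i" "n i"] n[OF i] m[OF i] signature[OF i]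
    by (metis gr0I not_numeral_le_zero)
  then obtain \<theta> where \<theta>: "\<And>i x y. i < k \<Longrightarrow> n i dvd x * y \<longleftrightarrow> m i dvd \<theta> i x * \<theta> i y"
    by metis
  \<comment> \<open>The componentwise images are glued to a single number by the Chinese remainder
    theorem.\<close>
  have "\<exists>z. \<forall>i<k. [z = \<theta> i (nat (xs ! i))] (mod m i)" for xs
    using chinese_remainder_nat[of "{..<k}" m "\<lambda>i. \<theta> i (nat (xs ! i))"] coprime_m by auto
  then obtain \<zeta> where \<zeta>: "\<And>xs i. i < k \<Longrightarrow> [\<zeta> xs = \<theta> i (nat (xs ! i))] (mod m i)"
    by metis
  let ?\<phi> = "\<lambda>xs. int (\<zeta> xs mod (\<Prod>i<k. m i))"
  have mem: "?\<phi> xs \<in> carrier residue_prod" for xs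
  proof -
    have "\<zeta> xs mod (\<Prod>i<k. m i) < (\<Prod>i<k. m i)"
      using one_less_prod_m by (intro mod_less_divisor) linarith
    \<comment> \<open>The carrier of \<open>residue_ring\<close> is a closed interval ending at the
      modulus minus one.\<close>
    then have "?\<phi> xs \<le> int (\<Prod>i<k. m i) - 1" by linarith
    then show ?thesis by (simp only: residue_ring_def partial_object.simps) simp
  qed
  have dvd: "m i dvd nat (?\<phi> u) * nat (?\<phi> v) \<longleftrightarrow> n i dvd nat (u ! i) * nat (v ! i)"
    if i: "i < k" for i u v
  proof -
    \<comment> \<open>Hence reducing modulo the product keeps the congruences modulo each
      \<open>m i\<close>.\<close>
    have "m i dvd (\<Prod>i<k. m i)" using i by (intro dvd_prodI) auto
    then have "[nat (?\<phi> xs) = \<theta> i (nat (xs ! i))] (mod m i)" for xs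
      using \<zeta>[OF i, of xs] by (simp add: cong_def mod_mod_cancel)
    then have "[nat (?\<phi> u) * nat (?\<phi> v) = \<theta> i (nat (u ! i)) * \<theta> i (nat (v ! i))] (mod m i)"
      by (intro cong_mult)
    then show ?thesis
      unfolding \<theta>[OF i] by (simp only: cong_def dvd_eq_mod_eq_0)
  qed
  show ?thesis
  proof (rule perfect_zero_divisor_graph_pullback[OF product_cring product_finite
        residue_prod_cring residue_prod_finite _ _ assms])
    show "?\<phi> ` carrier prod_ring \<subseteq> carrier residue_prod" using mem by blast
    fix u v assume "u \<in> carrier prod_ring" "v \<in> carrier prod_ring"
    then show "u \<otimes>\<^bsub>prod_ring\<^esub> v = \<zero>\<^bsub>prod_ring\<^esub> \<longleftrightarrow> ?\<phi> u \<otimes>\<^bsub>residue_prod\<^esub> ?\<phi> v = \<zero>\<^bsub>residue_prod\<^esub>"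
      using dvd by (simp only: product_mult_eq_zero_iff residue_prod_mult_eq_zero_iff[OF mem mem]) blast
  qed
qed

end

theorem theorem1p12:
  fixes k :: nat and n :: "nat \<Rightarrow> nat"
  assumes "k \<ge> 1" and "\<And>i. i < k \<Longrightarrow> n i \<ge> 2"
  shows "perfect_graph (with_proj (zero_divisor_graph
             (RDirProd_list (map (\<lambda>i. residue_ring (int (n i))) [0..<k])))) \<longleftrightarrow>
         (\<exists>m :: nat \<Rightarrow> nat.
            (\<forall>i<k. m i > 0) \<and>
            (\<forall>i<k. \<forall>j<k. i \<noteq> j \<longrightarrow> coprime (m i) (m j)) \<and>
            (\<forall>i<k. same_prime_signature (m i) (n i)) \<and>
            perfect_graph (with_proj (zero_divisor_graph (residue_ring (int (\<Prod>i<k. m i))))))"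
proof
  assume perf: "perfect_graph (with_proj (zero_divisor_graph
    (RDirProd_list (map (\<lambda>i. residue_ring (int (n i))) [0..<k]))))"
  \<comment> \<open>The transfer of perfection works for every such family \<open>m\<close>, so any
    choice of moduli serves as witness.\<close>
  obtain m where m: "\<And>i. i \<in> {..<k} \<Longrightarrow> m i > 0"
    "\<And>i j. \<lbrakk>i \<in> {..<k}; j \<in> {..<k}; i \<noteq> j\<rbrakk> \<Longrightarrow> coprime (m i) (m j)"
    "\<And>i. i \<in> {..<k} \<Longrightarrow> same_prime_signature (m i) (n i)"
    using ex_coprime_same_prime_signature[of "{..<k}" n] by blast
  have "perfect_graph (with_proj (zero_divisor_graph (residue_ring (int (\<Prod>i<k. m i)))))"
    using assms m by (intro perfect_residue_prod_if_perfect_product[OF _ _ _ _ _ perf]) auto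
  with m show "\<exists>m :: nat \<Rightarrow> nat.
            (\<forall>i<k. m i > 0) \<and>
            (\<forall>i<k. \<forall>j<k. i \<noteq> j \<longrightarrow> coprime (m i) (m j)) \<and>
            (\<forall>i<k. same_prime_signature (m i) (n i)) \<and>
            perfect_graph (with_proj (zero_divisor_graph (residue_ring (int (\<Prod>i<k. m i)))))"
    by (intro exI[of _ m]) auto
next
  assume "\<exists>m :: nat \<Rightarrow> nat.
            (\<forall>i<k. m i > 0) \<and>
            (\<forall>i<k. \<forall>j<k. i \<noteq> j \<longrightarrow> coprime (m i) (m j)) \<and>
            (\<forall>i<k. same_prime_signature (m i) (n i)) \<and>
            perfect_graph (with_proj (zero_divisor_graph (residue_ring (int (\<Prod>i<k. m i)))))"
  then obtain m where m: "\<forall>i<k. m i > 0"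
    "\<forall>i<k. \<forall>j<k. i \<noteq> j \<longrightarrow> coprime (m i) (m j)"
    "\<forall>i<k. same_prime_signature (m i) (n i)"
    and perf: "perfect_graph (with_proj (zero_divisor_graph (residue_ring (int (\<Prod>i<k. m i)))))"
    by blast
  show "perfect_graph (with_proj (zero_divisor_graph
    (RDirProd_list (map (\<lambda>i. residue_ring (int (n i))) [0..<k]))))"
    using assms m by (intro perfect_product_if_perfect_residue_prod[OF _ _ _ _ _ perf]) auto
qed

end
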